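(* Let $m$ be a deficient number, let $e\ge 1$ be an integer, and let $p$ be a prime with $\gcd(m,p)=1$. Then $mp^e$ is a primitive abundant number if and only if all of the following hold: (a) $p^e/\sigma(p^{e-1}) < c(m)$; (b) for each prime power $q^\alpha\,\|\,m$, $$\frac{p^e}{\sigma(p^{e-1})} > \frac{\sigma(m)}{d(m) + \frac{2m}{\sigma(q^\alpha)-1}};$$ (c) either $e=1$, or $p^{e-1}/\sigma(p^{e-2}) > c(m)$.
   Context: For $n\in\mathbb{N}$, $\sigma(n)=\sum_{d\mid n}d$ (so $\sigma(1)=1$). $n$ is deficient if $\sigma(n)<2n$, perfect if $\sigma(n)=2n$, abundant if $\sigma(n)>2n$, and non-deficient if perfect or abundant. The deficiency is $d(n)=2n-\sigma(n)$ and the center of $n$ is $c(n)=\sigma(n)/d(n)$. A number is primitive non-deficient if it is non-deficient and all its proper divisors are deficient. A primitive abundant number is a primitive non-deficient number that is abundant. $q^\alpha\,\|\,m$ means $q^\alpha\mid m$ and $q^{\alpha+1}\nmid m$. *)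

theory Defs
  imports Complex_Main "HOL-Computational_Algebra.Primes"
begin

definition sigma :: "nat \<Rightarrow> nat" where
  "sigma n = (\<Sum>d | d dvd n. d)"

definition deficient :: "nat \<Rightarrow> bool" where
  "deficient n \<longleftrightarrow> n > 0 \<and> sigma n < 2 * n"

(* The set of divisors of 0 is infinite, so sigma 0 = 0; without positivity
   0 would count as perfect. *)
definition perfect :: "nat \<Rightarrow> bool" where
  "perfect n \<longleftrightarrow> n > 0 \<and> sigma n = 2 * n"

definition abundant :: "nat \<Rightarrow> bool" where
  "abundant n \<longleftrightarrow> n > 0 \<and> sigma n > 2 * n"

definition non_deficient :: "nat \<Rightarrow> bool" where
  "non_deficient n \<longleftrightarrow> perfect n \<or> abundant n"

definition primitive_non_deficient :: "nat \<Rightarrow> bool" where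
  "primitive_non_deficient n \<longleftrightarrow>
     non_deficient n \<and> (\<forall>d. d dvd n \<and> d \<noteq> n \<longrightarrow> deficient d)"

definition primitive_abundant :: "nat \<Rightarrow> bool" where
  "primitive_abundant n \<longleftrightarrow> primitive_non_deficient n \<and> abundant n"

definition deficiency :: "nat \<Rightarrow> int" where
  "deficiency n = 2 * int n - int (sigma n)"

definition center :: "nat \<Rightarrow> real" where
  "center n = real (sigma n) / real_of_int (deficiency n)"

definition exactly_divides :: "nat \<Rightarrow> nat \<Rightarrow> nat \<Rightarrow> bool" where
  "exactly_divides q a m \<longleftrightarrow> q ^ a dvd m \<and> \<not> q ^ (a + 1) dvd m"

end

theory Submission
  imports Defs
begin

text \<open>
  Since \<open>\<sigma>(n)/n\<close> grows along divisibility, an abundant \<open>n\<close> is primitive as soon as \<open>n/r\<close> is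
  deficient for every prime \<open>r\<close> dividing \<open>n\<close>. For \<open>n = m p\<^sup>e\<close>, multiplicativity together with
  \<open>\<sigma>(p\<^sup>e) = p\<^sup>e + \<sigma>(p\<^sup>e\<^sup>-\<^sup>1)\<close> turns abundance of \<open>n\<close> into (a) and deficiency of \<open>n/p\<close> into (c).
  For a prime power \<open>q\<^sup>\<alpha>\<close> exactly dividing \<open>m\<close>, the identity \<open>q \<sigma>(q\<^sup>\<alpha>\<^sup>-\<^sup>1) = \<sigma>(q\<^sup>\<alpha>) - 1\<close> turns
  deficiency of \<open>n/q\<close> into (b).
\<close>

text \<open>For coprime factors, multiplication is a bijection from pairs of divisors onto the
  divisors of the product, so the divisor sum factors.\<close>

lemma sigma_mult_coprime:
  assumes "coprime a b" "a > 0" "b > 0"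
  shows "sigma (a * b) = sigma a * sigma b"
proof -
  let ?f = "\<lambda>(x, y). x * y :: nat"
  have "inj_on ?f ({d. d dvd a} \<times> {d. d dvd b})"
  proof (rule inj_onI, clarsimp)
    fix x y x' y' :: nat
    assume *: "x dvd a" "y dvd b" "x' dvd a" "y' dvd b" "x * y = x' * y'"
    \<comment> \<open>Coprimality across the two factors lets \<open>y'\<close> be cancelled from
      \<open>x dvd x' * y'\<close>, and symmetrically, so \<open>x\<close> and \<open>x'\<close>
      divide each other.\<close>
    then have "coprime x y'" "coprime x' y"
      using assms(1) coprime_divisors by blast+
    then have "x dvd x'" "x' dvd x"
      using *(5) by (metis coprime_dvd_mult_left_iff dvd_triv_left)+
    then have "x = x'" by (rule dvd_antisym)
    moreover have "x > 0" using * assms dvd_pos_nat by blast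
    ultimately show "x = x' \<and> y = y'" using *(5) by simp
  qed
  moreover have "?f ` ({d. d dvd a} \<times> {d. d dvd b}) = {d. d dvd a * b}"
  proof (intro subset_antisym subsetI)
    fix d assume "d \<in> {d. d dvd a * b}"
    then obtain x y where "d = x * y" "x dvd a" "y dvd b"
      using division_decomp[of d a b] by auto
    then show "d \<in> ?f ` ({d. d dvd a} \<times> {d. d dvd b})" by force
  qed (auto intro: mult_dvd_mono)
  ultimately have "sigma (a * b) = (\<Sum>z \<in> {d. d dvd a} \<times> {d. d dvd b}. ?f z)"
    unfolding sigma_def using sum.reindex[of ?f "{d. d dvd a} \<times> {d. d dvd b}" "\<lambda>d. d"]
    by (simp add: o_def del: sum.reindex)
  then show ?thesis
    by (simp add: sigma_def sum_product sum.cartesian_product)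
qed

text \<open>The map \<open>d \<mapsto> c * d\<close> embeds the divisors of \<open>a\<close> into
  those of \<open>a * c\<close>. This is the monotonicity of \<sigma>(n)/n along divisibility, free
  of division.\<close>

lemma sigma_mult_ge:
  assumes "a > 0" "c > 0"
  shows "c * sigma a \<le> sigma (a * c)"
proof -
  have "c * sigma a = (\<Sum>d \<in> (*) c ` {d. d dvd a}. d)"
    using assms by (subst sum.reindex) (auto simp: sigma_def sum_distrib_left inj_on_def)
  also have "\<dots> \<le> sigma (a * c)"
    unfolding sigma_def using assms by (intro sum_mono2) (auto simp: mult.commute)
  finally show ?thesis .
qed

lemma sigma_pos: "n > 0 \<Longrightarrow> sigma n > 0"
  using sigma_mult_ge[of 1 n] by (simp add: sigma_def)

lemma deficient_dvd:
  assumes "deficient b" "a dvd b"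
  shows "deficient a"
proof -
  from assms(2) obtain c where c: "b = a * c" ..
  with assms(1) have pos: "a > 0" "c > 0" by (auto simp: deficient_def)
  have "c * sigma a \<le> sigma b" using sigma_mult_ge[OF pos] by (simp add: c)
  also have "\<dots> < c * (2 * a)" using assms(1) by (simp add: c deficient_def mult_ac)
  finally show ?thesis using pos by (simp add: deficient_def)
qed

lemma sigma_prime_power:
  assumes "prime p"
  shows "sigma (p ^ e) = (\<Sum>i\<le>e. p ^ i)"
proof -
  have "{d. d dvd p ^ e} = (\<lambda>i. p ^ i) ` {..e}"
    using assms by (auto simp: divides_primepow_nat)
  moreover have "inj_on (\<lambda>i. p ^ i) {..e}"
    using prime_gt_1_nat[OF assms] by (auto simp: inj_on_def)
  ultimately show ?thesis by (simp add: sigma_def sum.reindex)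
qed

lemma sigma_prime_power_Suc:
  assumes "prime p"
  shows "sigma (p ^ Suc e) = p ^ Suc e + sigma (p ^ e)"
  using assms by (simp add: sigma_prime_power del: power_Suc)

text \<open>Splits off the lowest term of the geometric sum, where
  \<open>sigma_prime_power_Suc\<close> splits off the highest. This form is the source of the
  \<open>- 1\<close> in condition (b).\<close>

lemma sigma_prime_power_Suc':
  assumes "prime p"
  shows "sigma (p ^ Suc e) = p * sigma (p ^ e) + 1"
  unfolding sigma_prime_power[OF assms] by (subst sum.atMost_Suc_shift) (simp add: sum_distrib_left)

text \<open>A proper divisor \<open>d\<close> of \<open>n\<close> divides \<open>n div r\<close> for
  any prime \<open>r\<close> dividing the cofactor of \<open>d\<close>, and deficiency passes down
  to divisors. So only the maximal proper divisors need testing.\<close>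

lemma primitive_abundant_iff:
  "primitive_abundant n \<longleftrightarrow>
     abundant n \<and> (\<forall>r. prime r \<and> r dvd n \<longrightarrow> deficient (n div r))"
proof (cases "abundant n")
  case True
  then have n: "n > 0" by (simp add: abundant_def)
  have "(\<forall>d. d dvd n \<and> d \<noteq> n \<longrightarrow> deficient d) \<longleftrightarrow>
        (\<forall>r. prime r \<and> r dvd n \<longrightarrow> deficient (n div r))"
  proof (intro iffI allI impI)
    fix r assume A: "\<forall>d. d dvd n \<and> d \<noteq> n \<longrightarrow> deficient d" and r: "prime r \<and> r dvd n"
    then have "n div r < n" using n prime_gt_1_nat by simp
    moreover have "n div r dvd n" using r by (metis dvd_div_mult_self dvd_triv_left)
    ultimately show "deficient (n div r)" using A by simp
  next
    fix d assume A: "\<forall>r. prime r \<and> r dvd n \<longrightarrow> deficient (n div r)" and d: "d dvd n \<and> d \<noteq> n"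
    then obtain c where c: "n = d * c" by blast
    with d have "c \<noteq> 1" by auto
    then obtain r where r: "prime r" "r dvd c" using prime_factor_nat by blast
    then have "r dvd n" by (simp add: c)
    moreover have "d dvd n div r" using r by (auto simp: c div_mult_swap[symmetric])
    ultimately show "deficient d" using A r(1) deficient_dvd by blast
  qed
  with True show ?thesis
    by (simp add: primitive_abundant_def primitive_non_deficient_def non_deficient_def)
qed (simp add: primitive_abundant_def)

lemma exactly_divides_decomp:
  assumes "prime q" "m > 0"
  shows "exactly_divides q a m \<longleftrightarrow> (\<exists>k. m = q ^ a * k \<and> \<not> q dvd k)"
proof
  assume "exactly_divides q a m"
  then obtain k where "m = q ^ a * k" "\<not> q ^ (a + 1) dvd m"
    unfolding exactly_divides_def by blast
  then show "\<exists>k. m = q ^ a * k \<and> \<not> q dvd k"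
    by (auto simp: mult.commute intro: mult_dvd_mono)
next
  assume "\<exists>k. m = q ^ a * k \<and> \<not> q dvd k"
  then show "exactly_divides q a m"
    using assms by (auto simp: exactly_divides_def mult.commute)
qed

lemma deficiency_pos: "deficient m \<Longrightarrow> deficiency m > 0"
  by (simp add: deficient_def deficiency_def)

lemma real_deficiency: "real_of_int (deficiency m) = 2 * real m - real (sigma m)"
  by (simp add: deficiency_def)

lemma sigma_mult_prime_power_Suc:
  assumes "m > 0" "prime p" "\<not> p dvd m"
  shows "sigma (m * p ^ Suc e) = sigma m * (p ^ Suc e + sigma (p ^ e))"
proof -
  have "coprime m (p ^ Suc e)"
    using assms by (metis coprime_commute coprime_power_right_iff prime_imp_coprime)
  then show ?thesis
    using assms prime_gt_0_nat[OF assms(2)]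
    by (simp add: sigma_mult_coprime sigma_prime_power_Suc del: power_Suc)
qed

text \<open>With P and S as defined in the proof, \<open>2 * m * P\<close> is compared with
  \<open>sigma m * (P + S)\<close>. Moving \<open>sigma m * P\<close> across leaves P d(m) against
  \<sigma>(m) S, and d(m) and S are positive. The first part serves (a), the second serves (c) one
  exponent lower.\<close>

lemma abundant_mult_prime_power:
  assumes "deficient m" "prime p" "\<not> p dvd m"
  shows "abundant (m * p ^ Suc e) \<longleftrightarrow> real (p ^ Suc e) / real (sigma (p ^ e)) < center m"
    and "deficient (m * p ^ Suc e) \<longleftrightarrow> real (p ^ Suc e) / real (sigma (p ^ e)) > center m"
proof -
  have m: "m > 0" using assms by (simp add: deficient_def)
  have d: "real_of_int (deficiency m) > 0" using deficiency_pos[OF assms(1)] by simp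
  have p: "p > 0" using assms(2) prime_gt_0_nat by blast
  define P S where "P = p ^ Suc e" and "S = sigma (p ^ e)"
  have pos: "P > 0" "S > 0" using p sigma_pos by (simp_all add: P_def S_def)
  have eq: "sigma (m * P) = sigma m * (P + S)"
    using sigma_mult_prime_power_Suc[OF m assms(2,3)] by (simp add: P_def S_def)
  have "abundant (m * P) \<longleftrightarrow> real (2 * (m * P)) < real (sigma m * (P + S))"
    using m pos eq by (simp add: abundant_def del: of_nat_mult of_nat_add)
  also have "\<dots> \<longleftrightarrow> real P * real_of_int (deficiency m) < real (sigma m) * real S"
    by (simp add: real_deficiency algebra_simps)
  also have "\<dots> \<longleftrightarrow> real P / real S < center m"
    using d pos unfolding center_def by (simp add: divide_simps)
  finally show "abundant (m * p ^ Suc e) \<longleftrightarrow> real (p ^ Suc e) / real (sigma (p ^ e)) < center m"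
    by (simp add: P_def S_def)
  have "deficient (m * P) \<longleftrightarrow> real (2 * (m * P)) > real (sigma m * (P + S))"
    using m pos eq by (simp add: deficient_def del: of_nat_mult of_nat_add)
  also have "\<dots> \<longleftrightarrow> real P * real_of_int (deficiency m) > real (sigma m) * real S"
    by (simp add: real_deficiency algebra_simps)
  also have "\<dots> \<longleftrightarrow> real P / real S > center m"
    using d pos unfolding center_def by (simp add: divide_simps)
  finally show "deficient (m * p ^ Suc e) \<longleftrightarrow> real (p ^ Suc e) / real (sigma (p ^ e)) > center m"
    by (simp add: P_def S_def)
qed

lemma deficient_div_prime_iff:
  assumes "deficient m" "prime p" "\<not> p dvd m"
    and q: "prime q" "exactly_divides q (Suc a) m"
  shows "deficient (m * p ^ Suc e div q) \<longleftrightarrow>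
     real (p ^ Suc e) / real (sigma (p ^ e)) >
       real (sigma m) /
         (real_of_int (deficiency m) + 2 * real m / (real (sigma (q ^ Suc a)) - 1))"
proof -
  have m: "m > 0" using assms by (simp add: deficient_def)
  have d: "real_of_int (deficiency m) > 0" using deficiency_pos[OF assms(1)] by simp
  have p: "p > 0" and q0: "q > 0" using assms(2) q(1) prime_gt_0_nat by blast+
  define P S R where "P = p ^ Suc e" and "S = sigma (p ^ e)" and "R = sigma (q ^ a)"
  have pos: "P > 0" "S > 0" "R > 0" using p q0 sigma_pos by (simp_all add: P_def S_def R_def)
  have Q: "sigma (q ^ Suc a) = q * R + 1"
    using sigma_prime_power_Suc'[OF q(1)] by (simp add: R_def)
  obtain k where k: "m = q ^ Suc a * k" "\<not> q dvd k"
    using q m exactly_divides_decomp by blast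
  have k0: "k > 0" using k(1) m by (cases k) auto
  \<comment> \<open>The exponent is left free: \<open>Suc a\<close> is used for
    \<open>sigma m\<close>, and \<open>a\<close> for the quotient by \<open>q\<close>.\<close>
  have cop: "coprime (q ^ b) k" for b
    using k(2) q(1) by (metis coprime_power_left_iff prime_imp_coprime)
  have sm: "sigma m = (q * R + 1) * sigma k"
    using sigma_mult_coprime[OF cop] k(1) k0 q0 Q by (simp del: power_Suc)
  have div: "m * p ^ Suc e div q = q ^ a * k * P"
    using q0 by (simp add: k(1) P_def mult.assoc)
  have ndvd: "\<not> p dvd q ^ a * k" using assms(3) by (auto simp: k(1) mult.assoc)
  have "sigma (q ^ a * k * P) = R * sigma k * (P + S)"
    using sigma_mult_prime_power_Suc[OF _ assms(2) ndvd, of e] sigma_mult_coprime[OF cop] k0 q0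
    by (simp add: P_def S_def R_def del: power_Suc)
  then have "deficient (q ^ a * k * P) \<longleftrightarrow> R * sigma k * (P + S) < 2 * (q ^ a * k * P)"
    using q0 k0 pos by (simp add: deficient_def)
  \<comment> \<open>The factor \<open>q * R + 1\<close> completes \<open>sigma k\<close> to
    \<open>sigma m\<close>, and \<open>q\<close> completes \<open>q ^ a * k\<close> to
    \<open>m\<close>, so that \<open>k\<close> disappears.\<close>
  also have "\<dots> \<longleftrightarrow>
      (q * R + 1) * q * (R * sigma k * (P + S)) < (q * R + 1) * q * (2 * (q ^ a * k * P))"
    using q0 by (subst mult_less_cancel1) simp
  also have "\<dots> \<longleftrightarrow> q * R * (sigma m * (P + S)) < (q * R + 1) * (2 * m * P)"
  proof -
    have "(q * R + 1) * q * (R * sigma k * (P + S)) = q * R * (sigma m * (P + S))"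
      by (simp only: sm mult_ac)
    moreover have "(q * R + 1) * q * (2 * (q ^ a * k * P)) = (q * R + 1) * (2 * m * P)"
      by (simp add: k(1) algebra_simps)
    ultimately show ?thesis by (simp only:)
  qed
  also have "\<dots> \<longleftrightarrow> real (q * R * (sigma m * (P + S))) < real ((q * R + 1) * (2 * m * P))"
    by (simp only: of_nat_less_iff)
  \<comment> \<open>Divide by \<open>q * R\<close>, which is \<open>sigma (q ^ Suc a) - 1\<close>,
    and move \<open>sigma m * P\<close> to the right, where it combines with
    \<open>2 * m * P\<close> to give the deficiency.\<close>
  also have "\<dots> \<longleftrightarrow> real (sigma m) * real S <
      real P * (real_of_int (deficiency m) + 2 * real m / real (q * R))"
    using q0 pos by (simp add: real_deficiency field_simps)
  also have "\<dots> \<longleftrightarrow> real P / real S >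
      real (sigma m) / (real_of_int (deficiency m) + 2 * real m / real (q * R))"
  proof -
    have "real_of_int (deficiency m) + 2 * real m / real (q * R) > 0"
      using d by (intro add_pos_nonneg) auto
    then show ?thesis using pos by (simp add: pos_divide_less_eq pos_less_divide_eq mult.commute)
  qed
  finally show ?thesis
    unfolding div Q by (simp add: P_def S_def)
qed

theorem theorem2p8:
  fixes m e p :: nat
  assumes "deficient m" and "e \<ge> 1" and "prime p" and "gcd m p = 1"
  shows "primitive_abundant (m * p ^ e) \<longleftrightarrow>
     real (p ^ e) / real (sigma (p ^ (e - 1))) < center m \<and>
     (\<forall>q \<alpha>. prime q \<and> \<alpha> \<ge> 1 \<and> exactly_divides q \<alpha> m \<longrightarrow>
        real (p ^ e) / real (sigma (p ^ (e - 1))) >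
          real (sigma m) /
            (real_of_int (deficiency m) + 2 * real m / (real (sigma (q ^ \<alpha>)) - 1))) \<and>
     (e = 1 \<or> real (p ^ (e - 1)) / real (sigma (p ^ (e - 2))) > center m)"
proof -
  obtain f where e: "e = Suc f" using assms(2) by (cases e) auto
  have m: "m > 0" using assms(1) by (simp add: deficient_def)
  have p: "p > 0" using assms(3) prime_gt_0_nat by blast
  have ndvd: "\<not> p dvd m"
    using assms(3,4) by (metis gcd_nat.absorb2 not_prime_1)
  let ?B = "\<lambda>q a. real (p ^ e) / real (sigma (p ^ (e - 1))) >
          real (sigma m) /
            (real_of_int (deficiency m) + 2 * real m / (real (sigma (q ^ a)) - 1))"
  have B: "deficient (m * p ^ e div q) \<longleftrightarrow> ?B q a"
    if "prime q" "a \<ge> 1" "exactly_divides q a m" for q a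
    using deficient_div_prime_iff[OF assms(1,3) ndvd that(1), of "a - 1" f] that
    by (simp add: e del: power_Suc)
  \<comment> \<open>Together with \<open>dvd\<close>, this matches the primes dividing
    \<open>m\<close> with the prime powers over which (b) ranges.\<close>
  have ex: "\<exists>a\<ge>1. exactly_divides q a m" if q: "prime q" "q dvd m" for q
  proof -
    obtain a k where ak: "m = q ^ a * k" "\<not> q dvd k"
      using multiplicity_decompose'[of m q] m q(1) by (metis not_prime_unit not_gr0)
    moreover from this q(2) have "a \<ge> 1" by (cases a) auto
    ultimately show ?thesis using exactly_divides_decomp[OF q(1) m] by blast
  qed
  have dvd: "q dvd m" if "a \<ge> 1" "exactly_divides q a m" for q a
    using that by (meson dvd_power dvd_trans exactly_divides_def less_le_trans zero_less_one)
  have C: "deficient (m * p ^ e div p) \<longleftrightarrow>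
      e = 1 \<or> real (p ^ (e - 1)) / real (sigma (p ^ (e - 2))) > center m"
  proof (cases f)
    \<comment> \<open>Here the quotient is \<open>m\<close> itself, deficient by assumption. The
      disjunct \<open>e = 1\<close> covers this case, in which \<open>e - 2\<close> is truncated to
      0.\<close>
    case 0
    then show ?thesis using assms(1) p by (simp add: e)
  next
    case (Suc g)
    have "m * p ^ e div p = m * p ^ Suc g" using p by (simp add: e Suc)
    then show ?thesis
      using abundant_mult_prime_power(2)[OF assms(1,3) ndvd, of g] by (simp add: e Suc)
  qed
  \<comment> \<open>Separates the quotients by primes of \<open>m\<close>, which give (b), from the
    quotient by \<open>p\<close>, which gives (c).\<close>
  have primes: "(\<forall>r. prime r \<and> r dvd m * p ^ e \<longrightarrow> D r) \<longleftrightarrow>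
      (\<forall>r. prime r \<and> r dvd m \<longrightarrow> D r) \<and> D p" for D
  proof -
    have "r dvd m * p ^ e \<longleftrightarrow> r dvd m \<or> r = p" if "prime r" for r
      using that assms(3) by (auto simp: prime_dvd_mult_iff e simp del: power_Suc dest: prime_dvd_power primes_dvd_imp_eq)
    then show ?thesis using assms(3) by blast
  qed
  have "(\<forall>r. prime r \<and> r dvd m \<longrightarrow> deficient (m * p ^ e div r)) \<longleftrightarrow>
      (\<forall>q a. prime q \<and> a \<ge> 1 \<and> exactly_divides q a m \<longrightarrow> ?B q a)"
    using B ex dvd by blast
  moreover have "abundant (m * p ^ e) \<longleftrightarrow>
      real (p ^ e) / real (sigma (p ^ (e - 1))) < center m"
    using abundant_mult_prime_power(1)[OF assms(1,3) ndvd, of f] by (simp add: e)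
  ultimately show ?thesis
    unfolding primitive_abundant_iff primes C by blast
qed

end
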